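(* Let $\lambda\ge 0$. Suppose that $(x_0,y_0,y_1,\ldots,y_b)$ is a $T$-periodic solution of the system $$\dot\xi=G(\xi)+\lambda F(t,\xi),\qquad \xi\in\mathbb{R}^{b+2}.$$ Then $x_0$ is a $T$-periodic solution of $$\ddot x(t)=g\Big(x(t),\dot x(t),\int_{-\infty}^t\gamma_a^b(t-s)\,\varphi(x(s),\dot x(s))\,ds\Big)+\lambda f\big(t,x(t),\dot x(t)\big).$$
   Context: Let $a>0$, $b\in\mathbb{N}\setminus\{0\}$, $T>0$. Let $g\colon\mathbb{R}^3\to\mathbb{R}$ be continuous, $\varphi\colon\mathbb{R}^2\to\mathbb{R}$ locally Lipschitz, and $f\colon\mathbb{R}^3\to\mathbb{R}$ continuous and $T$-periodic in its first variable. The gamma probability density $\gamma_a^b$ is $$\gamma_a^b(s)=\frac{a^b s^{b-1}e^{-as}}{(b-1)!}\ \text{ for } s\ge 0,\qquad \gamma_a^b(s)=0\ \text{ for } s<0.$$ The maps $G\colon\mathbb{R}^{b+2}\to\mathbb{R}^{b+2}$ and $F\colon\mathbb{R}\times\mathbb{R}^{b+2}\to\mathbb{R}^{b+2}$ are $$G(u,v_0,v_1,\ldots,v_b)=\big(v_0,\;g(u,v_0,v_b),\;a(\varphi(u,v_0)-v_1),\;a(v_1-v_2),\ldots,a(v_{b-1}-v_b)\big),$$ $$F(t,u,v_0,v_1,\ldots,v_b)=\big(0,f(t,u,v_0),0,\ldots,0\big)\quad(\text{with } b \text{ trailing zeros}).$$ A $T$-periodic solution of the second order equation is a $C^2$ function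 $x\colon\mathbb{R}\to\mathbb{R}$ of period $T$ satisfying the equation identically on $\mathbb{R}$; a $T$-periodic solution of the system is a $C^1$ function $\xi\colon\mathbb{R}\to\mathbb{R}^{b+2}$ of period $T$ satisfying the system identically on $\mathbb{R}$. *)

theory Defs
  imports "HOL-Probability.Probability"
begin

definition gamma_density :: "real \<Rightarrow> nat \<Rightarrow> real \<Rightarrow> real" where
  "gamma_density a b s =
     (if 0 \<le> s then a ^ b * s ^ (b - 1) * exp (- a * s) / fact (b - 1) else 0)"

lemma gamma_density_eq_erlang_density:
  "1 \<le> b \<Longrightarrow> gamma_density a b s = erlang_density (b - 1) a s"
  by (cases b) (auto simp: gamma_density_def erlang_density_def)

text \<open>The library's \<^const>\<open>local_lipschitz\<close> concerns families depending on a parameter;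
  this is the version for a single map.\<close>

definition locally_lipschitz :: "('a::metric_space \<Rightarrow> 'b::metric_space) \<Rightarrow> bool" where
  "locally_lipschitz h \<longleftrightarrow> (\<forall>p. \<exists>r>0. \<exists>L. L-lipschitz_on (ball p r) h)"

text \<open>A vector \<open>(u, v\<^sub>0, \<dots>, v\<^sub>b)\<close> of \<open>(b+2)\<close>-dimensional space is encoded as
  \<open>w :: nat \<Rightarrow> real\<close>, with \<open>w 0 = u\<close> and \<open>w (k + 1) = v\<^sub>k\<close> for \<open>k \<le> b\<close>. Only the components with
  index below \<open>b + 2\<close> are meaningful.\<close>

definition G_map ::
  "real \<Rightarrow> nat \<Rightarrow> (real \<times> real \<times> real \<Rightarrow> real) \<Rightarrow> (real \<times> real \<Rightarrow> real)
    \<Rightarrow> (nat \<Rightarrow> real) \<Rightarrow> (nat \<Rightarrow> real)" where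
  "G_map a b g \<phi> w i =
     (if i = 0 then w 1
      else if i = 1 then g (w 0, w 1, w (b + 1))
      else if i = 2 then a * (\<phi> (w 0, w 1) - w 2)
      else if i < b + 2 then a * (w (i - 1) - w i)
      else 0)"

definition F_map ::
  "(real \<times> real \<times> real \<Rightarrow> real) \<Rightarrow> real \<Rightarrow> (nat \<Rightarrow> real) \<Rightarrow> (nat \<Rightarrow> real)" where
  "F_map f t w i = (if i = 1 then f (t, w 0, w 1) else 0)"

definition periodic_system_solution ::
  "real \<Rightarrow> nat \<Rightarrow> real \<Rightarrow> (real \<times> real \<times> real \<Rightarrow> real) \<Rightarrow> (real \<times> real \<Rightarrow> real)
    \<Rightarrow> (real \<times> real \<times> real \<Rightarrow> real) \<Rightarrow> real \<Rightarrow> (real \<Rightarrow> nat \<Rightarrow> real) \<Rightarrow> bool" where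
  "periodic_system_solution a b T g \<phi> f lam \<xi> \<longleftrightarrow>
     (\<forall>i < b + 2.
        (\<lambda>t. \<xi> t i) C1_differentiable_on UNIV \<and>
        periodic_fun_simple (\<lambda>t. \<xi> t i) T \<and>
        (\<forall>t. ((\<lambda>t. \<xi> t i) has_real_derivative
                G_map a b g \<phi> (\<xi> t) i + lam * F_map f t (\<xi> t) i) (at t)))"

text \<open>Being \<open>C\<^sup>2\<close> is expressed by \<open>x\<close> and its derivative both being \<open>C\<^sup>1\<close>. Since the Lebesgue
  integral of a non-integrable function is \<open>0\<close> by convention, convergence of the delay integral
  is required explicitly.\<close>

definition periodic_delay_solution ::
  "real \<Rightarrow> nat \<Rightarrow> real \<Rightarrow> (real \<times> real \<times> real \<Rightarrow> real) \<Rightarrow> (real \<times> real \<Rightarrow> real)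
    \<Rightarrow> (real \<times> real \<times> real \<Rightarrow> real) \<Rightarrow> real \<Rightarrow> (real \<Rightarrow> real) \<Rightarrow> bool" where
  "periodic_delay_solution a b T g \<phi> f lam x \<longleftrightarrow>
     x C1_differentiable_on UNIV \<and> deriv x C1_differentiable_on UNIV \<and>
     periodic_fun_simple x T \<and>
     (\<forall>t. set_integrable lborel {..t} (\<lambda>s. gamma_density a b (t - s) * \<phi> (x s, deriv x s)) \<and>
          deriv (deriv x) t =
            g (x t, deriv x t,
               LINT s:{..t}|lborel. gamma_density a b (t - s) * \<phi> (x s, deriv x s))
            + lam * f (t, x t, deriv x t))"

end

theory Submission
  imports Defs
begin

text \<open>Put \<open>p s = \<phi> (x s, x' s)\<close>. The last \<open>b\<close> equations form a linear chain driven by \<open>p\<close>, so that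
  \<open>\<Sum>k<b. (a (t - s)) ^ k / k! * exp (- a (t - s)) * y\<^sub>b\<^sub>-\<^sub>k s\<close> has, as a function of \<open>s\<close>, a telescoping
  derivative equal to the delay integrand \<open>\<gamma> (t - s) * p s\<close>. This primitive equals \<open>y\<^sub>b t\<close> at \<open>s = t\<close>,
  and it tends to \<open>0\<close> as \<open>s\<close> tends to \<open>-\<infinity>\<close> because periodic solutions are bounded.\<close>

lemma locally_lipschitz_continuous_on:
  assumes "locally_lipschitz h"
  shows "continuous_on UNIV h"
proof -
  have "isCont h p" for p
  proof -
    obtain r L where "r > 0" "L-lipschitz_on (ball p r) h"
      using assms unfolding locally_lipschitz_def by blast
    then show ?thesis
      by (meson lipschitz_on_continuous_on continuous_on_eq_continuous_at open_ball centre_in_ball)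
  qed
  then show ?thesis
    by (simp add: continuous_on_eq_continuous_at)
qed

text \<open>Translation by a whole number of periods moves every argument into
  \<open>{0..T}\<close>, so the range is already the image of a compact interval.\<close>

lemma continuous_periodic_bounded:
  fixes h :: "real \<Rightarrow> 'a::metric_space"
  assumes "continuous_on UNIV h" "periodic_fun_simple h T" "T > 0"
  shows "bounded (range h)"
proof -
  interpret periodic_fun_simple h T by fact
  have "h t \<in> h ` {0..T}" for t
  proof (rule image_eqI)
    define n where "n = \<lfloor>t / T\<rfloor>"
    show "h t = h (t - of_int n * T)"
      by (simp add: minus_of_int)
    have "of_int n \<le> t / T" "t / T \<le> of_int n + 1"
      unfolding n_def by linarith+
    then show "t - of_int n * T \<in> {0..T}"
      using \<open>T > 0\<close> by (simp add: field_simps)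
  qed
  then have "range h \<subseteq> h ` {0..T}" by blast
  moreover have "compact (h ` {0..T})"
    using assms(1) by (intro compact_continuous_image) (auto intro: continuous_on_subset)
  ultimately show ?thesis
    using bounded_subset compact_imp_bounded by blast
qed

text \<open>The Erlang density is a probability density, so its total mass is one and in particular
  finite.\<close>

lemma integrable_gamma_density:
  assumes "a > 0" "b \<noteq> 0"
  shows "integrable lborel (gamma_density a b)"
proof -
  let ?f = "erlang_density (b - 1) a"
  have "gamma_density a b = ?f"
    using assms by (auto simp: gamma_density_eq_erlang_density)
  moreover have "integrable lborel ?f"
  proof (rule integrableI_nonneg)
    interpret prob_space "density lborel ?f"
      using \<open>a > 0\<close> by (rule prob_space_erlang_density)
    show "(\<integral>\<^sup>+ x. ennreal (?f x) \<partial>lborel) < \<infinity>"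
      using emeasure_space_1 by (simp add: emeasure_density)
  qed (use \<open>a > 0\<close> in auto)
  ultimately show ?thesis by simp
qed

text \<open>The product is dominated by a constant multiple of the density, reflected and translated
  by s -> t - s, which is integrable on the whole line.\<close>

lemma integrable_gamma_density_mult:
  assumes "a > 0" "b \<noteq> 0" and p: "p \<in> borel_measurable borel" "bounded (range p)"
  shows "integrable lborel (\<lambda>s. gamma_density a b (t - s) * p s)"
proof -
  obtain B where B: "\<And>s. norm (p s) \<le> B"
    using p(2) by (auto simp: bounded_iff)
  have "integrable lborel (\<lambda>s. gamma_density a b (t + (- 1) * s))"
    using integrable_gamma_density[OF assms(1,2)] by (rule lborel_integrable_real_affine) simp
  then have int: "integrable lborel (\<lambda>s. gamma_density a b (t - s))" by simp
  show ?thesis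
  proof (rule Bochner_Integration.integrable_bound)
    show "integrable lborel (\<lambda>s. B * gamma_density a b (t - s))"
      using int by simp
    show "(\<lambda>s. gamma_density a b (t - s) * p s) \<in> borel_measurable lborel"
      using borel_measurable_integrable[OF int] p(1) by simp
    show "AE s in lborel. norm (gamma_density a b (t - s) * p s)
        \<le> norm (B * gamma_density a b (t - s))"
    proof (rule AE_I2)
      fix s
      have "\<bar>p s\<bar> \<le> \<bar>B\<bar>" using B[of s] by simp
      then show "norm (gamma_density a b (t - s) * p s) \<le> norm (B * gamma_density a b (t - s))"
        by (simp add: abs_mult mult.commute[of "\<bar>B\<bar>"] mult_left_mono)
    qed
  qed
qed

text \<open>For s \<le> t and a > 0 the weight of \<open>y (b - k)\<close> is the gamma density of
  order k + 1 divided by a. It is not cut off for s > t, so the sum has a two-sided derivative even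
  at s = t.\<close>

definition chain_primitive :: "real \<Rightarrow> nat \<Rightarrow> (nat \<Rightarrow> real \<Rightarrow> real) \<Rightarrow> real \<Rightarrow> real \<Rightarrow> real" where
  "chain_primitive a b y t s =
     (\<Sum>k<b. (a * (t - s)) ^ k / fact k * exp (- (a * (t - s))) * y (b - k) s)"

text \<open>Only the term k = 0 survives, its power being \<open>0 ^ 0 = 1\<close>.\<close>

lemma chain_primitive_self: "b \<noteq> 0 \<Longrightarrow> chain_primitive a b y t t = y b t"
  by (cases b) (simp_all add: chain_primitive_def sum.lessThan_Suc_shift del: sum.lessThan_Suc)

text \<open>Writing \<open>e k\<close> for the weights, (e k)' = a e k - a e (k - 1), the last term
  being absent for k = 0. In the product rule a e k is cancelled by the decay rate -a of
  \<open>y (b - k)\<close>; a difference of neighbouring terms remains.\<close>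

lemma chain_primitive_has_real_derivative:
  assumes "b \<noteq> 0" "s \<le> t"
    and y: "\<And>k. k < b \<Longrightarrow>
      (y (Suc k) has_real_derivative a * (y k s - y (Suc k) s)) (at s)"
  shows "(chain_primitive a b y t has_real_derivative gamma_density a b (t - s) * y 0 s) (at s)"
proof -
  define e where "e k s = (a * (t - s)) ^ k / fact k * exp (- (a * (t - s)))" for k s
  \<comment> \<open>These are the telescoping terms: \<open>E 0 = 0\<close>, while
    \<open>E b\<close> pairs the last weight with the input \<open>y 0\<close>. Since s \<le> t, a
    times that weight is the gamma density.\<close>
  define E where "E k = (if k = 0 then 0 else a * e (k - 1) s * y (b - k) s)" for k
  have e: "(e k has_real_derivative a * e k s - (if k = 0 then 0 else a * e (k - 1) s)) (at s)" for k
  proof (cases k)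
    case 0
    then show ?thesis
      unfolding e_def by (auto intro!: derivative_eq_intros)
  next
    case (Suc n)
    have "((\<lambda>s. (a * (t - s)) ^ Suc n) has_real_derivative (1 + of_nat n) * (- a * (a * (t - s)) ^ n)) (at s)"
      by (rule DERIV_power_Suc) (auto intro!: derivative_eq_intros)
    from DERIV_cdivide[OF this, of "fact (Suc n)"]
    have "((\<lambda>s. (a * (t - s)) ^ Suc n / fact (Suc n)) has_real_derivative
        - a * ((a * (t - s)) ^ n / fact n)) (at s)"
      by (rule DERIV_cong) (use of_nat_neq_0[of n, where 'a = real] in simp)
    moreover have "((\<lambda>s. exp (- (a * (t - s)))) has_real_derivative a * exp (- (a * (t - s)))) (at s)"
      by (auto intro!: derivative_eq_intros)
    ultimately have "((\<lambda>s. (a * (t - s)) ^ Suc n / fact (Suc n) * exp (- (a * (t - s)))) has_real_derivative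
        - a * ((a * (t - s)) ^ n / fact n) * exp (- (a * (t - s)))
        + a * exp (- (a * (t - s))) * ((a * (t - s)) ^ Suc n / fact (Suc n))) (at s)"
      by (rule DERIV_mult)
    then show ?thesis
      unfolding e_def Suc by (rule DERIV_cong) (simp add: mult_ac del: power_Suc fact_Suc)
  qed
  have "((\<lambda>s. e k s * y (b - k) s) has_real_derivative E (Suc k) - E k) (at s)" if "k < b" for k
  proof -
    have "(y (b - k) has_real_derivative a * (y (b - Suc k) s - y (b - k) s)) (at s)"
      using y[of "b - Suc k"] that by (simp add: Suc_diff_Suc)
    from DERIV_mult[OF e[of k] this] show ?thesis
      by (rule DERIV_cong) (auto simp: E_def algebra_simps)
  qed
  then have "((\<lambda>s. \<Sum>k<b. e k s * y (b - k) s) has_real_derivative (\<Sum>k<b. E (Suc k) - E k)) (at s)"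
    by (intro DERIV_sum) auto
  moreover have "(\<Sum>k<b. E (Suc k) - E k) = gamma_density a b (t - s) * y 0 s"
  proof -
    obtain m where "b = Suc m" using \<open>b \<noteq> 0\<close> by (cases b) auto
    then show ?thesis
      using \<open>s \<le> t\<close>
      by (simp only: sum_lessThan_telescope) (simp add: E_def e_def gamma_density_def power_mult_distrib)
  qed
  ultimately show ?thesis
    unfolding e_def chain_primitive_def[abs_def] by simp
qed

text \<open>Exponential decay beats each polynomial factor, and bounded factors preserve the limit
  0. For k < b the index b - k is at least 1, so the input \<open>y 0\<close> does not occur in the
  sum.\<close>

lemma chain_primitive_tendsto_at_bot:
  assumes "a > 0" and y: "\<And>k. \<lbrakk>0 < k; k \<le> b\<rbrakk> \<Longrightarrow> bounded (range (y k))"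
  shows "(chain_primitive a b y t \<longlongrightarrow> 0) at_bot"
proof -
  have lim: "filterlim (\<lambda>s. a * (t - s)) at_top at_bot"
    using \<open>a > 0\<close> by real_asymp
  have "((\<lambda>s. (a * (t - s)) ^ k / fact k * exp (- (a * (t - s))) * y (b - k) s) \<longlongrightarrow> 0) at_bot"
    if "k < b" for k
  proof -
    obtain B where B: "\<And>s. norm (y (b - k) s) \<le> B"
      using y[of "b - k"] \<open>k < b\<close> by (auto simp: bounded_iff)
    have "((\<lambda>s. (a * (t - s)) ^ k / exp (a * (t - s)) / fact k) \<longlongrightarrow> 0) at_bot"
      using tendsto_divide[OF filterlim_compose[OF tendsto_power_div_exp_0 lim] tendsto_const,
          of "fact k" k] by simp
    then have "((\<lambda>s. (a * (t - s)) ^ k / fact k * exp (- (a * (t - s)))) \<longlongrightarrow> 0) at_bot"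
      by (simp add: exp_minus divide_inverse mult_ac)
    then show ?thesis
      by (rule lim_null_mult_right_bounded[where B = B]) (simp add: B del: real_norm_def)
  qed
  then have "((\<lambda>s. \<Sum>k<b. (a * (t - s)) ^ k / fact k * exp (- (a * (t - s))) * y (b - k) s)
      \<longlongrightarrow> (\<Sum>k<b. 0)) at_bot"
    by (intro tendsto_sum) auto
  then show ?thesis
    unfolding chain_primitive_def[abs_def] by simp
qed

lemma linear_chain_integral:
  assumes "a > 0" "b \<noteq> 0"
    and y: "\<And>k s. k < b \<Longrightarrow>
      (y (Suc k) has_real_derivative a * (y k s - y (Suc k) s)) (at s)"
    and bdd: "\<And>k. k \<le> b \<Longrightarrow> bounded (range (y k))"
    and cont: "continuous_on UNIV (y 0)"
  shows "set_integrable lborel {..t} (\<lambda>s. gamma_density a b (t - s) * y 0 s)"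
    and "(LINT s:{..t}|lborel. gamma_density a b (t - s) * y 0 s) = y b t"
proof -
  let ?h = "\<lambda>s. gamma_density a b (t - s) * y 0 s"
  let ?H = "chain_primitive a b y t"
  \<comment> \<open>The integrand may change sign, so the fundamental theorem on an unbounded
    interval asks for integrability beforehand; the bound on the input supplies it.\<close>
  have int: "integrable lborel ?h"
    using assms(1,2) borel_measurable_continuous_onI[OF cont] bdd[of 0]
    by (intro integrable_gamma_density_mult) auto
  then have set_int: "set_integrable lborel A ?h" if "A \<in> sets lborel" for A
    using integrable_mult_indicator[OF that int] by (simp add: set_integrable_def)
  then show "set_integrable lborel {..t} ?h" by simp
  have deriv: "(?H has_real_derivative ?h s) (at s)" if "s \<le> t" for s
    using assms(2) that y by (rule chain_primitive_has_real_derivative)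
  \<comment> \<open>The density jumps at 0 when b = 1, so continuity is claimed only for s < t,
    where the integrand agrees locally with the smooth formula times \<open>y 0\<close>.\<close>
  have h_cont: "isCont ?h s" if "s < t" for s
  proof -
    let ?h' = "\<lambda>s. a ^ b * (t - s) ^ (b - 1) * exp (- a * (t - s)) / fact (b - 1) * y 0 s"
    have "isCont (y 0) s" using cont by (simp add: continuous_on_eq_continuous_at)
    then have cont': "isCont ?h' s"
      by (intro continuous_intros) auto
    have "eventually (\<lambda>s. ?h s = ?h' s) (nhds s)"
      using eventually_nhds_in_open[of "{..<t}" s] that
      by (auto simp: gamma_density_def elim!: eventually_mono)
    from isCont_cong[OF this] cont' show ?thesis by blast
  qed
  have "(LBINT s=-\<infinity>..ereal t. ?h s) = ?H t - 0"
  proof (rule interval_integral_FTC_integrable)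
    show "- \<infinity> < ereal t" by simp
    show "(?H has_vector_derivative ?h s) (at s)" if "- \<infinity> < ereal s" "ereal s < ereal t" for s
      using deriv[of s] that by (simp add: has_real_derivative_iff_has_vector_derivative)
    show "isCont ?h s" if "- \<infinity> < ereal s" "ereal s < ereal t" for s
      using h_cont that by simp
    show "set_integrable lborel (einterval (- \<infinity>) (ereal t)) ?h"
      by (intro set_int) simp
    show "((?H \<circ> real_of_ereal) \<longlongrightarrow> 0) (at_right (- \<infinity>))"
      using chain_primitive_tendsto_at_bot[OF assms(1) bdd]
      by (simp add: ereal_tendsto_simps)
    have "isCont ?H t" using deriv[of t] DERIV_isCont by blast
    then show "((?H \<circ> real_of_ereal) \<longlongrightarrow> ?H t) (at_left (ereal t))"
      by (simp add: ereal_tendsto_simps isCont_def filterlim_at_split)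
  qed
  \<comment> \<open>The interval integral runs over the open half-line; adding the endpoint t
    changes it by a null set.\<close>
  moreover have "(LBINT s=-\<infinity>..ereal t. ?h s) = (LINT s:{..t}|lborel. ?h s)"
  proof -
    have "(LBINT s=-\<infinity>..ereal t. ?h s) = (LINT s:{..<t}|lborel. ?h s)"
      by (simp add: interval_lebesgue_integral_def einterval_def lessThan_def)
    also have "\<dots> = (LINT s:{..t}|lborel. ?h s)"
    proof (rule set_integral_null_delta[OF int])
      have "sym_diff {..<t} {..t} = {t}" by auto
      then show "sym_diff {..<t} {..t} \<in> null_sets lborel"
        by (simp add: finite_imp_null_set_lborel)
    qed simp_all
    finally show ?thesis .
  qed
  ultimately show "(LINT s:{..t}|lborel. ?h s) = y b t"
    using assms(2) by (simp add: chain_primitive_self)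
qed

theorem theorem2p4:
  fixes a T lam :: real and b :: nat
    and g f :: "real \<times> real \<times> real \<Rightarrow> real"
    and \<phi> :: "real \<times> real \<Rightarrow> real"
    and \<xi> :: "real \<Rightarrow> nat \<Rightarrow> real"
  assumes "a > 0" and "b \<noteq> 0" and "T > 0"
    and "continuous_on UNIV g"
    and "locally_lipschitz \<phi>"
    and "continuous_on UNIV f"
    and "\<And>u v. periodic_fun_simple (\<lambda>t. f (t, u, v)) T"
    and "lam \<ge> 0"
    and "periodic_system_solution a b T g \<phi> f lam \<xi>"
  shows "periodic_delay_solution a b T g \<phi> f lam (\<lambda>t. \<xi> t 0)"
proof -
  have C1: "(\<lambda>t. \<xi> t i) C1_differentiable_on UNIV"
    and per: "periodic_fun_simple (\<lambda>t. \<xi> t i) T"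
    and der: "((\<lambda>t. \<xi> t i) has_real_derivative
                G_map a b g \<phi> (\<xi> t) i + lam * F_map f t (\<xi> t) i) (at t)"
    if "i < b + 2" for i t
    using assms(9) that unfolding periodic_system_solution_def by blast+
  have cont: "continuous_on UNIV (\<lambda>t. \<xi> t i)" if "i < b + 2" for i
    using der[OF that] by (meson DERIV_isCont continuous_at_imp_continuous_on)
  \<comment> \<open>The first equation identifies x' with component 1, so the C1 property of
    components 0 and 1 makes x a C2 function.\<close>
  have deriv0: "deriv (\<lambda>t. \<xi> t 0) = (\<lambda>t. \<xi> t 1)"
    using der[of 0] by (intro ext DERIV_imp_deriv) (simp add: G_map_def F_map_def)
  have deriv1: "deriv (\<lambda>t. \<xi> t 1) t = g (\<xi> t 0, \<xi> t 1, \<xi> t (b + 1)) + lam * f (t, \<xi> t 0, \<xi> t 1)" for t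
    using der[of 1 t] by (intro DERIV_imp_deriv) (simp add: G_map_def F_map_def)
  \<comment> \<open>Slot 0 holds the input \<open>\<phi>\<close> instead of v_0 = x'. The equation
    for v_1 then has the same form as those for v_2, ..., v_b.\<close>
  define y where "y k t = (if k = 0 then \<phi> (\<xi> t 0, \<xi> t 1) else \<xi> t (k + 1))" for k t
  have y: "(y (Suc k) has_real_derivative a * (y k s - y (Suc k) s)) (at s)" if "k < b" for k s
    using der[of "k + 2" s] that by (cases "k = 0") (simp_all add: y_def[abs_def] G_map_def F_map_def numeral_2_eq_2)
  have y_cont: "continuous_on UNIV (y k)" if "k \<le> b" for k
  proof (cases "k = 0")
    case True
    have "continuous_on UNIV (\<lambda>t. \<phi> (\<xi> t 0, \<xi> t 1))"
      by (rule continuous_on_compose2[OF locally_lipschitz_continuous_on[OF assms(5)]])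
        (auto intro!: continuous_on_Pair cont)
    with True show ?thesis by (simp add: y_def[abs_def])
  next
    case False
    then show ?thesis using cont[of "k + 1"] that by (simp add: y_def[abs_def])
  qed
  \<comment> \<open>As \<open>\<phi>\<close> has no explicit time argument, \<open>y 0\<close>
    inherits the period of the solution.\<close>
  have y_per: "periodic_fun_simple (y k) T" if "k \<le> b" for k
  proof
    fix t
    have "\<xi> (t + T) i = \<xi> t i" if "i < b + 2" for i
      using periodic_fun_simple.plus_period[OF per[OF that]] .
    with that show "y k (t + T) = y k t" by (simp add: y_def)
  qed
  have bdd: "bounded (range (y k))" if "k \<le> b" for k
    using y_cont[OF that] y_per[OF that] assms(3) by (rule continuous_periodic_bounded)
  note chain = linear_chain_integral[OF assms(1,2) y bdd y_cont[of 0]]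
  have "set_integrable lborel {..t} (\<lambda>s. gamma_density a b (t - s) * \<phi> (\<xi> s 0, \<xi> s 1))"
    and "(LINT s:{..t}|lborel. gamma_density a b (t - s) * \<phi> (\<xi> s 0, \<xi> s 1)) = \<xi> t (b + 1)" for t
    using chain[of t] assms(2) by (simp_all add: y_def)
  then show ?thesis
    unfolding periodic_delay_solution_def deriv0 using C1[of 0] C1[of 1] per[of 0] deriv1 by simp
qed

end
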